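(* Let $H\in\mathbb{R}^{n\times n}$ be the distance matrix for a set of points in hyperbolic space, and let $\Delta(H)\in\mathbb{R}^{n\times n}$ be a symmetric perturbation with zero diagonal (so that $\hat H=H+\Delta(H)$ remains symmetric). Let $X\in\mathbb{R}^{n\times r}$ be the configuration recovered from $H$ with h-MDS, and let $\hat X$ be the configuration recovered with h-MDS from the perturbed distances $H+\Delta(H)$. If $\lambda_{\min}$ denotes the smallest nonzero eigenvalue of $XX^T$, then up to second order in $\Delta(H)$, $$D_E(X,\hat X)\le\frac{2n^2}{\lambda_{\min}}\sinh^2\left(\|H\|_\infty\right)\|\Delta(H)\|_\infty^2 .$$
   Context: Hyperboloid model: $\mathbb{M}_r=\{x\in\mathbb{R}^{r+1}:x^TQx=1,\ x_0>0\}$, $Q=\mathrm{diag}(1,-1,\dots,-1)$, with $d_H(x,y)=\operatorname{acosh}(x^TQy)$; a point $x\in\mathbb{M}_r$ is determined by its last $r$ coordinates $\vec{x}\in\mathbb{R}^r$ since $x_0=\sqrt{1+\|\vec{x}\|^2}$, and a configuration of $n$ points is written as the $n\times r$ matrix with rows $\vec{x}_i$. h-MDS with rank $r$ applied to a symmetric matrix $H$ of (possibly perturbed) distances: form $Y_{i,j}=\cosh(H_{i,j})$ and run PCA on $-Y$ with rank $r$, i.e. return the $n\times r$ matrix whose columns are the $r$ most significant eigenvectors of $-Y$ with non-negative eigenvalue, each scaled by the square root of its eigenvalue. For exact hyperbolic distances this recovers a configuration $X$ in the hyperboloid model satisfying $X^Tu=0$ and $Y=uu^T-XX^T$, where $u_i=\sqrt{1+\|\vec{x}_i\|^2}$.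 $\|A\|_\infty=\max_{i,j}|A_{i,j}|$. For configurations $X,Z\in\mathbb{R}^{n\times r}$, $D(X,Z)=\operatorname{trace}((X-Z)^T(X-Z))$, and $D_E(X,Z)=\inf\{D(X,ZP):P\in\mathbb{R}^{r\times r},\ P^TP=I\}$, the gap minimized over rotations and reflections of the points of the second configuration. "Up to second order in $\Delta(H)$" means that terms of order higher than two in $\Delta(H)$ are neglected.
   Formalization: The recovered configuration X is additionally assumed to have full rank r; without this the claim fails, e.g. for r=2 and three points on a geodesic, where a perturbation of size ε changes D_E by order ε. *)

theory Defs
  imports "HOL-Analysis.Analysis"
begin

text \<open>
  The ambient space of dimension \<open>r + 1\<close> is \<^typ>\<open>real ^ 'r option\<close>:
  the index \<^term>\<open>None\<close> is the time-like coordinate number 0 and the indices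
  \<open>Some k\<close> are the \<open>r\<close> space-like coordinates.
\<close>

definition mink_Q :: "real ^ ('r::finite option) ^ ('r option)" where
  "mink_Q = (\<chi> a b. if a = b then (if a = None then 1 else - 1) else 0)"

definition hyperboloid :: "(real ^ ('r::finite option)) set" where
  "hyperboloid = {x. x \<bullet> (mink_Q *v x) = 1 \<and> x $ None > 0}"

definition hyp_dist :: "real ^ ('r::finite option) \<Rightarrow> real ^ 'r option \<Rightarrow> real" where
  "hyp_dist x y = arcosh (x \<bullet> (mink_Q *v y))"

text \<open>
  h-MDS with rank \<open>CARD('r)\<close>, as a relation between the input and its possible
  outputs: eigenvectors are only determined up to sign and, for repeated eigenvalues, up to
  a rotation of the eigenspace.  The pair \<open>v\<close>, \<open>l\<close> is an orthonormal eigenbasis of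
  \<open>- Y\<close> with its eigenvalues, and \<open>s\<close> selects the \<open>r\<close> basis vectors with the
  largest eigenvalues.  There is no output if \<open>- Y\<close> has fewer than \<open>r\<close> non-negative
  eigenvalues (counted with multiplicity).
\<close>

definition hMDS :: "real ^ 'n ^ 'n \<Rightarrow> real ^ 'r ^ 'n \<Rightarrow> bool" where
  "hMDS H X \<longleftrightarrow>
     (let Y = (\<chi> i j. cosh (H $ i $ j)) in
      \<exists>(v :: 'n \<Rightarrow> real ^ 'n) (l :: 'n \<Rightarrow> real) (s :: 'r \<Rightarrow> 'n).
        (\<forall>a b. v a \<bullet> v b = (if a = b then 1 else 0)) \<and>
        (\<forall>a. (- Y) *v v a = l a *\<^sub>R v a) \<and>
        inj s \<and>
        (\<forall>k. l (s k) \<ge> 0) \<and>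
        (\<forall>k. \<forall>a. a \<notin> range s \<longrightarrow> l a \<le> l (s k)) \<and>
        (\<forall>k. column k X = sqrt (l (s k)) *\<^sub>R v (s k)))"

definition max_norm :: "real ^ 'm ^ 'n \<Rightarrow> real" where
  "max_norm A = (MAX (i, j) \<in> UNIV. \<bar>A $ i $ j\<bar>)"

definition eigenvalues :: "real ^ 'n ^ 'n \<Rightarrow> real set" where
  "eigenvalues A = {c. \<exists>x. x \<noteq> 0 \<and> A *v x = c *\<^sub>R x}"

definition lambda_min :: "real ^ 'r ^ 'n \<Rightarrow> real" where
  "lambda_min X = Min (eigenvalues (X ** transpose X) - {0})"

definition config_gap :: "real ^ 'r ^ 'n \<Rightarrow> real ^ 'r ^ 'n \<Rightarrow> real" where
  "config_gap X Z = trace (transpose (X - Z) ** (X - Z))"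

definition config_gap_E :: "real ^ 'r ^ 'n \<Rightarrow> real ^ 'r ^ 'n \<Rightarrow> real" where
  "config_gap_E X Z = (INF P \<in> {P :: real ^ 'r ^ 'r. transpose P ** P = mat 1}. config_gap X (Z ** P))"

end

theory Submission
  imports Defs
begin

text \<open>
  Write \<open>A = - Y\<close> and \<open>A'\<close> for its perturbation, \<open>G\<close> and \<open>G'\<close> for the Gram matrices
  \<open>X ** transpose X\<close> and \<open>X' ** transpose X'\<close>, and \<open>e\<close> for a bound of the Frobenius norm
  of \<open>A' - A\<close>. On the kernel of the matrix of space-like coordinates \<open>A\<close> is negative
  semidefinite, so by a dimension count the eigenvalues dropped by h-MDS are at most \<open>0\<close>
  for \<open>A\<close> and at most \<open>e\<close> for \<open>A'\<close>. Truncating a spectrum in this way is nearly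
  \<open>1\<close>-Lipschitz: \<open>g = norm (G' - G)\<close> satisfies \<open>g\<^sup>2 \<le> e * g + e * g\<^sup>2 / \<lambda>\<^sub>m\<^sub>i\<^sub>n\<close>. Aligning
  \<open>X'\<close> with \<open>X\<close> by the orthogonal polar factor of \<open>transpose X ** X'\<close> gives
  \<open>D\<^sub>E \<le> (5/4) * g\<^sup>2 / \<lambda>\<^sub>m\<^sub>i\<^sub>n\<close>, and the slack between \<open>5/4\<close> and \<open>2\<close> absorbs the factor
  \<open>g / e\<close> when \<open>e \<le> \<lambda>\<^sub>m\<^sub>i\<^sub>n / 5\<close>. Finally \<open>e\<close> is bounded by the Taylor expansion of \<open>cosh\<close>.
\<close>

subsection \<open>The Frobenius inner product\<close>

lemma inner_matrix: "(A :: real^'m^'n) \<bullet> B = (\<Sum>i\<in>UNIV. \<Sum>j\<in>UNIV. A $ i $ j * B $ i $ j)"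
  by (simp add: inner_vec_def)

lemma inner_transpose: "transpose (A :: real^'m^'n) \<bullet> transpose B = A \<bullet> B"
  unfolding inner_matrix by (subst sum.swap) (simp add: transpose_def)

text \<open>This rule and its counterpart for right factors stand in for cyclic permutation under
  the trace in the computations below.\<close>

lemma inner_matrix_mult_left:
  fixes A :: "real^'k^'n" and B :: "real^'m^'k"
  shows "(A ** B) \<bullet> C = B \<bullet> (transpose A ** C)"
proof -
  have "(A ** B) \<bullet> C = (\<Sum>i\<in>UNIV. \<Sum>j\<in>UNIV. \<Sum>k\<in>UNIV. A $ i $ k * B $ k $ j * C $ i $ j)"
    by (simp add: inner_matrix matrix_matrix_mult_def sum_distrib_right)
  also have "\<dots> = (\<Sum>j\<in>UNIV. \<Sum>i\<in>UNIV. \<Sum>k\<in>UNIV. A $ i $ k * B $ k $ j * C $ i $ j)"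
    by (rule sum.swap)
  also have "\<dots> = (\<Sum>j\<in>UNIV. \<Sum>k\<in>UNIV. \<Sum>i\<in>UNIV. A $ i $ k * B $ k $ j * C $ i $ j)"
    by (intro sum.cong refl sum.swap)
  also have "\<dots> = (\<Sum>k\<in>UNIV. \<Sum>j\<in>UNIV. \<Sum>i\<in>UNIV. A $ i $ k * B $ k $ j * C $ i $ j)"
    by (rule sum.swap)
  also have "\<dots> = B \<bullet> (transpose A ** C)"
    by (simp add: inner_matrix matrix_matrix_mult_def transpose_def sum_distrib_left mult_ac)
  finally show ?thesis .
qed

lemma inner_matrix_mult_right:
  fixes A :: "real^'k^'n" and B :: "real^'m^'k"
  shows "(A ** B) \<bullet> C = A \<bullet> (C ** transpose B)"
proof -
  have "(A ** B) \<bullet> C = (transpose B ** transpose A) \<bullet> transpose C"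
    by (metis inner_transpose matrix_transpose_mul)
  also have "\<dots> = transpose A \<bullet> (B ** transpose C)"
    by (simp add: inner_matrix_mult_left)
  also have "\<dots> = A \<bullet> (C ** transpose B)"
    by (metis inner_transpose matrix_transpose_mul transpose_transpose)
  finally show ?thesis .
qed

lemma trace_eq_inner: "trace (transpose A ** B) = A \<bullet> (B :: real^'m^'n)"
proof -
  have "trace (transpose A ** B) = mat 1 \<bullet> (transpose A ** B)"
    by (simp add: trace_def inner_matrix mat_def if_distrib[of "\<lambda>x. x * _"] cong: if_cong)
  also have "\<dots> = A \<bullet> B"
    by (metis inner_matrix_mult_left matrix_mul_rid)
  finally show ?thesis .
qed

lemma inner_matrix_columns:
  "(A :: real^'m^'n) \<bullet> B = (\<Sum>j\<in>UNIV. column j A \<bullet> column j B)"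
  unfolding inner_matrix by (subst sum.swap) (simp add: inner_vec_def column_def)

lemma inner_matrix_rows:
  "(A :: real^'m^'n) \<bullet> B = (\<Sum>i\<in>UNIV. row i A \<bullet> row i B)"
  by (simp add: inner_vec_def row_def)

lemma transpose_diff: "transpose (A - B) = transpose A - transpose (B :: real^'m^'n)"
  by (simp add: transpose_def vec_eq_iff)

lemma norm_matrix_vector_le: "norm (A *v x) \<le> norm (A :: real^'m^'n) * norm x"
proof (rule power2_le_imp_le)
  have "(norm (A *v x))\<^sup>2 = (\<Sum>i\<in>UNIV. (A $ i \<bullet> x)\<^sup>2)"
    unfolding power2_norm_eq_inner
    by (simp add: inner_vec_def[of "A *v x"] matrix_vector_mul_component power2_eq_square)
  also have "\<dots> \<le> (\<Sum>i\<in>UNIV. (A $ i \<bullet> A $ i) * (x \<bullet> x))"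
    by (intro sum_mono Cauchy_Schwarz_ineq)
  also have "\<dots> = (norm A * norm x)\<^sup>2"
    unfolding power_mult_distrib power2_norm_eq_inner
    by (simp add: inner_vec_def[of A] sum_distrib_right)
  finally show "(norm (A *v x))\<^sup>2 \<le> (norm A * norm x)\<^sup>2" .
qed simp

text \<open>Source of the factor n^2 in the final estimate: errors are measured in the Frobenius
  norm but assumed small entrywise.\<close>

lemma norm_matrix_le_entries:
  fixes A :: "real^'n^'n"
  assumes "\<And>i j. \<bar>A $ i $ j\<bar> \<le> b"
  shows "norm A \<le> real CARD('n) * b"
proof (rule power2_le_imp_le)
  have "(norm A)\<^sup>2 = (\<Sum>i\<in>UNIV. \<Sum>j\<in>UNIV. (A $ i $ j)\<^sup>2)"
    unfolding power2_norm_eq_inner by (simp add: inner_matrix power2_eq_square)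
  also have "\<dots> \<le> (\<Sum>(i::'n)\<in>UNIV. \<Sum>(j::'n)\<in>UNIV. b\<^sup>2)"
    by (intro sum_mono) (use assms in \<open>metis abs_ge_zero power2_abs power_mono\<close>)
  also have "\<dots> = (real CARD('n) * b)\<^sup>2"
    by (simp add: power2_eq_square)
  finally show "(norm A)\<^sup>2 \<le> (real CARD('n) * b)\<^sup>2" .
  have "0 \<le> b" using assms[of undefined undefined] by (meson abs_ge_zero order_trans)
  then show "0 \<le> real CARD('n) * b" by simp
qed

text \<open>Invariance of the Frobenius product under an orthogonal change of basis. It lets
  products of matrices be evaluated in the eigenbasis of \<open>A\<close> or of \<open>A'\<close>,
  whichever is convenient.\<close>

lemma inner_orthonormal_basis:
  fixes v :: "'n::finite \<Rightarrow> real^'n" and M W :: "real^'n^'m"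
  assumes "\<And>a b. v a \<bullet> v b = (if a = b then 1 else 0)"
  shows "M \<bullet> W = (\<Sum>a\<in>UNIV. (M *v v a) \<bullet> (W *v v a))"
proof -
  define V :: "real^'n^'n" where "V = (\<chi> i a. v a $ i)"
  have "transpose V ** V = mat 1"
    using assms by (simp add: V_def vec_eq_iff matrix_matrix_mult_def transpose_def mat_def inner_vec_def)
  then have "V ** transpose V = mat 1"
    by (simp add: matrix_left_right_inverse)
  then have "M \<bullet> W = (M ** V) \<bullet> (W ** V)"
    by (metis inner_matrix_mult_right inner_commute matrix_mul_assoc matrix_mul_rid)
  also have "\<dots> = (\<Sum>a\<in>UNIV. (M *v v a) \<bullet> (W *v v a))"
    unfolding inner_matrix_columns
    by (intro sum.cong refl) (simp add: V_def column_def matrix_matrix_mult_def matrix_vector_mult_def)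
  finally show ?thesis .
qed

subsection \<open>Orthogonal alignment\<close>

text \<open>Expand the difference of Gram matrices in \<open>D = Z - X\<close>. Alignment makes
  \<open>S\<close> symmetric, so the two linear terms do not cancel each other, and positivity of
  \<open>transpose X ** Z\<close> keeps the cross term \<open>K \<bullet> S\<close> above
  \<open>- (T \<bullet> T)\<close>.\<close>

lemma procrustes_bound:
  fixes X Z :: "real^'r^'n"
  assumes sym: "transpose (transpose X ** Z) = transpose X ** Z"
    and psd: "\<And>y. 0 \<le> y \<bullet> ((transpose X ** Z) *v y)"
    and lam: "\<And>y. c * (y \<bullet> y) \<le> (X *v y) \<bullet> (X *v y)"
  shows "4 / 5 * c * ((X - Z) \<bullet> (X - Z)) \<le> (norm (Z ** transpose Z - X ** transpose X))\<^sup>2"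
proof -
  define D where "D = Z - X"
  define S where "S = transpose X ** D"
  define K where "K = transpose D ** D"
  define T where "T = X ** transpose D"
  define W where "W = Z ** transpose Z - X ** transpose X"
  have Z: "Z = X + D" by (simp add: D_def)
  have W: "W = T + transpose T + D ** transpose D"
    unfolding W_def Z T_def
    by (simp add: vec_eq_iff matrix_matrix_mult_def transpose_def algebra_simps sum.distrib)
  have S: "S = transpose X ** Z - transpose X ** X"
    by (simp add: S_def D_def matrix_matrix_mult_def vec_eq_iff right_diff_distrib sum_subtractf)
  have S_sym: "transpose S = S"
    using sym by (simp add: S transpose_diff matrix_transpose_mul)
  have TT: "T \<bullet> transpose T = S \<bullet> S"
  proof -
    have "T \<bullet> transpose T = transpose D \<bullet> (transpose X ** (D ** transpose X))"
      by (simp add: T_def inner_matrix_mult_left matrix_transpose_mul)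
    also have "\<dots> = (transpose D ** X) \<bullet> S"
      by (simp add: inner_matrix_mult_right[of "transpose D"] S_def matrix_mul_assoc)
    \<comment> \<open>Symmetry of \<open>S\<close> turns this product into a squared norm, hence a
      nonnegative quantity.\<close>
    also have "transpose D ** X = transpose S" by (simp add: S_def matrix_transpose_mul)
    finally show ?thesis by (simp add: S_sym)
  qed
  have KK: "(D ** transpose D) \<bullet> (D ** transpose D) = K \<bullet> K"
  proof -
    have "(D ** transpose D) \<bullet> (D ** transpose D) = transpose D \<bullet> (K ** transpose D)"
      by (simp add: inner_matrix_mult_left K_def matrix_mul_assoc)
    also have "\<dots> = (transpose D ** D) \<bullet> K"
      by (rule inner_matrix_mult_right[symmetric])
    finally show ?thesis by (simp add: K_def)
  qed
  have TK: "T \<bullet> (D ** transpose D) = K \<bullet> S"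
  proof -
    have "T \<bullet> (D ** transpose D) = transpose D \<bullet> (S ** transpose D)"
      by (simp add: T_def inner_matrix_mult_left S_def matrix_mul_assoc)
    also have "\<dots> = K \<bullet> S"
      unfolding K_def by (rule inner_matrix_mult_right[symmetric])
    finally show ?thesis .
  qed
  have TK': "transpose T \<bullet> (D ** transpose D) = K \<bullet> S"
    using TK inner_transpose[of T "D ** transpose D"] by (simp add: matrix_transpose_mul)
  have T: "T \<bullet> T = K \<bullet> (transpose X ** X)"
  proof -
    have "T \<bullet> T = transpose D \<bullet> ((transpose X ** X) ** transpose D)"
      by (simp add: T_def inner_matrix_mult_left matrix_mul_assoc)
    also have "\<dots> = K \<bullet> (transpose X ** X)"
      unfolding K_def by (rule inner_matrix_mult_right[symmetric])
    finally show ?thesis .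
  qed
  \<comment> \<open>Written over the rows of \<open>D\<close>, this product is a sum of values of
    the quadratic form of \<open>transpose X ** Z\<close>.\<close>
  have "K \<bullet> (transpose X ** Z) = D \<bullet> (D ** (transpose X ** Z))"
    by (simp add: K_def inner_matrix_mult_left)
  also have "\<dots> = (\<Sum>i\<in>UNIV. row i D \<bullet> ((transpose X ** Z) *v row i D))"
  proof -
    have "row i (D ** (transpose X ** Z)) = row i D v* (transpose X ** Z)" for i
      by (simp add: vec_eq_iff row_def matrix_matrix_mult_def vector_matrix_mult_def mult.commute)
    then have "row i (D ** (transpose X ** Z)) = (transpose X ** Z) *v row i D" for i
      by (metis sym vector_transpose_matrix)
    then show ?thesis unfolding inner_matrix_rows by simp
  qed
  also have "\<dots> \<ge> 0" by (intro sum_nonneg psd)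
  finally have psdK: "0 \<le> K \<bullet> (transpose X ** Z)" .
  \<comment> \<open>The columns of \<open>T\<close> are the images under \<open>X\<close> of the
    rows of \<open>D\<close>, so \<open>lam\<close> applies to each of them.\<close>
  have "c * (D \<bullet> D) = (\<Sum>i\<in>UNIV. c * (row i D \<bullet> row i D))"
    by (simp add: inner_matrix_rows sum_distrib_left)
  also have "\<dots> \<le> (\<Sum>i\<in>UNIV. (X *v row i D) \<bullet> (X *v row i D))"
    by (intro sum_mono lam)
  also have "\<dots> = T \<bullet> T"
    unfolding inner_matrix_columns[of T]
    by (intro sum.cong refl)
      (simp add: T_def column_def row_def matrix_matrix_mult_def matrix_vector_mult_def transpose_def)
  finally have lamD: "c * (D \<bullet> D) \<le> T \<bullet> T" .
  have "W \<bullet> W = 2 * (T \<bullet> T) + 2 * (S \<bullet> S) + K \<bullet> K + 4 * (K \<bullet> S)"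
    using TT KK TK TK' inner_transpose[of T T]
    by (simp add: W inner_add_left inner_add_right inner_commute)
  \<comment> \<open>Completing the square with any \<open>b\<close> such that \<open>b\<^sup>2 \<le> 2\<close> leaves \<open>(2 * b - 2) * (T \<bullet> T)\<close>;
    \<open>b = 7/5\<close> is a rational stand-in for the square root of \<open>2\<close>.\<close>
  moreover have "0 \<le> (K + (7/5) *\<^sub>R S) \<bullet> (K + (7/5) *\<^sub>R S)" by simp
  then have "0 \<le> K \<bullet> K + 14/5 * (K \<bullet> S) + 49/25 * (S \<bullet> S)"
    by (simp add: inner_add_left inner_add_right inner_commute algebra_simps)
  moreover have "K \<bullet> S = K \<bullet> (transpose X ** Z) - T \<bullet> T"
    by (simp add: S T inner_diff_right)
  moreover have "0 \<le> S \<bullet> S" by simp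
  ultimately have "4/5 * (c * (D \<bullet> D)) \<le> W \<bullet> W"
    using psdK lamD by argo
  moreover have "(X - Z) \<bullet> (X - Z) = D \<bullet> D"
    by (simp add: D_def inner_diff_left inner_diff_right)
  ultimately show ?thesis
    by (simp add: W_def power2_norm_eq_inner mult.assoc)
qed

section \<open>Reflections and the orthogonal polar factor\<close>

definition reflection :: "real^'n \<Rightarrow> real^'n^'n" where
  "reflection a = (\<chi> i j. (if i = j then 1 else 0) - 2 * a $ i * a $ j / (a \<bullet> a))"

lemma reflection_vector: "reflection a *v x = x - (2 * (a \<bullet> x) / (a \<bullet> a)) *\<^sub>R a"
proof -
  have "(\<Sum>j\<in>UNIV. ((if i = j then 1 else 0) - 2 * a $ i * a $ j / (a \<bullet> a)) * x $ j)
      = (\<Sum>j\<in>UNIV. (if i = j then x $ j else 0) - 2 * (a $ j * x $ j) / (a \<bullet> a) * a $ i)" for i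
    by (intro sum.cong refl) (simp add: left_diff_distrib)
  then show ?thesis
    by (simp add: reflection_def vec_eq_iff matrix_vector_mult_def sum_subtractf
        inner_vec_def[of a x] sum_distrib_left sum_distrib_right sum_divide_distrib)
qed

lemma transpose_reflection: "transpose (reflection a) = reflection a"
  by (simp add: reflection_def transpose_def vec_eq_iff mult_ac)

lemma reflection_orthogonal: "transpose (reflection a) ** reflection a = mat 1"
proof (cases "a = 0")
  \<comment> \<open>Division by zero yields 0, so \<open>reflection 0\<close> is the
    identity.\<close>
  case True
  then show ?thesis
    by (auto simp: matrix_eq matrix_vector_mul_assoc[symmetric] transpose_reflection reflection_vector)
next
  case False
  then show ?thesis
    by (auto simp: matrix_eq matrix_vector_mul_assoc[symmetric] transpose_reflection
        reflection_vector inner_diff_right)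
qed

lemma inner_reflection:
  fixes M :: "real^'n^'n"
  shows "M \<bullet> reflection a = M \<bullet> mat 1 - 2 * (a \<bullet> (M *v a)) / (a \<bullet> a)"
proof -
  have r: "reflection a = mat 1 - (2 / (a \<bullet> a)) *\<^sub>R (\<chi> i j. a $ i * a $ j)"
    by (simp add: reflection_def mat_def vec_eq_iff)
  have "M \<bullet> (\<chi> i j. a $ i * a $ j) = a \<bullet> (M *v a)"
    by (simp add: inner_matrix inner_vec_def matrix_vector_mult_def sum_distrib_left mult_ac)
  then show ?thesis by (simp add: r inner_diff_right)
qed

lemma compact_orthogonal: "compact {P :: real^'r^'r. transpose P ** P = mat 1}"
proof -
  have "norm P \<le> sqrt (real CARD('r))" if "transpose P ** P = mat 1" for P :: "real^'r^'r"
  proof -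
    have "P \<bullet> P = trace (mat 1 :: real^'r^'r)"
      using trace_eq_inner[of P P] that by simp
    then show ?thesis by (simp add: norm_eq_sqrt_inner trace_I)
  qed
  then have "bounded {P :: real^'r^'r. transpose P ** P = mat 1}"
    by (auto simp: bounded_iff)
  moreover have "closed {P :: real^'r^'r. transpose P ** P = mat 1}"
    unfolding matrix_matrix_mult_def transpose_def
    by (intro closed_Collect_eq continuous_intros)
  ultimately show ?thesis by (simp add: compact_eq_bounded_closed)
qed

text \<open>An orthogonal \<open>P\<close> maximising the trace of \<open>B ** P\<close> cannot be improved by
  composing it with one reflection, which gives positivity, nor with a product of two,
  which gives symmetry.\<close>

lemma polar_factor:
  fixes B :: "real^'r^'r"
  obtains P :: "real^'r^'r" where "transpose P ** P = mat 1"
    "transpose (B ** P) = B ** P" "\<And>y. 0 \<le> y \<bullet> ((B ** P) *v y)"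
proof -
  let ?O = "{P :: real^'r^'r. transpose P ** P = mat 1}"
  have "mat 1 \<in> ?O" by simp
  then have ne: "?O \<noteq> {}" by blast
  have "continuous_on ?O (\<lambda>P. transpose B \<bullet> P)" by (intro continuous_intros)
  from continuous_attains_sup[OF compact_orthogonal ne this]
  obtain P where P: "P \<in> ?O" and max: "\<And>R. R \<in> ?O \<Longrightarrow> transpose B \<bullet> R \<le> transpose B \<bullet> P"
    by blast
  define N where "N = transpose (B ** P)"
  \<comment> \<open>Orthogonal matrices are closed under products, so maximality at \<open>P\<close>
    becomes maximality of \<open>N \<bullet> R\<close> at the identity.\<close>
  have N: "N \<bullet> R \<le> N \<bullet> mat 1" if "transpose R ** R = mat 1" for R
  proof -
    have "transpose (P ** R) ** (P ** R) = transpose R ** (transpose P ** P) ** R"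
      by (simp add: matrix_transpose_mul matrix_mul_assoc)
    then have "P ** R \<in> ?O" using that P by simp
    from max[OF this] have "transpose B \<bullet> (P ** R) \<le> transpose B \<bullet> P" .
    moreover have "N \<bullet> R = transpose B \<bullet> (P ** R)" for R
      by (simp add: N_def matrix_transpose_mul inner_matrix_mult_left)
    ultimately show ?thesis by simp
  qed
  have psd: "0 \<le> y \<bullet> (N *v y)" for y
  proof (cases "y = 0")
    case False
    have "N \<bullet> reflection y \<le> N \<bullet> mat 1"
      by (rule N[OF reflection_orthogonal])
    then have "0 \<le> 2 * (y \<bullet> (N *v y)) / (y \<bullet> y)"
      by (simp add: inner_reflection)
    moreover have "0 < y \<bullet> y" using False by simp
    ultimately show ?thesis unfolding zero_le_divide_iff by argo
  qed simp
  have comp: "N $ j $ i \<le> N $ i $ j" if "i \<noteq> j" for i j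
  proof -
    let ?x = "axis i (1::real)" and ?y = "axis j (1::real)"
    have ax: "axis k 1 \<bullet> (N *v axis l 1) = N $ k $ l" for k l
      by (simp add: matrix_vector_mult_basis column_def inner_axis')
    \<comment> \<open>Test maximality on the product of the reflections along \<open>?x\<close> and
      \<open>?x + t *\<^sub>R ?y\<close>, a rotation in the plane of the two axes. The antisymmetric
      part of \<open>N\<close> enters at first order in \<open>t\<close>, the diagonal only at
      second order.\<close>
    have *: "t * (N $ j $ i - N $ i $ j) \<le> t * (t * (N $ i $ i + N $ j $ j))" for t
    proof -
      define a where "a = ?x + t *\<^sub>R ?y"
      have aa: "a \<bullet> a = 1 + t\<^sup>2"
        using that by (auto simp: a_def inner_add_left inner_add_right inner_axis_axis power2_eq_square)
      have ax1: "?x \<bullet> a = 1"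
        using that by (auto simp: a_def inner_add_right inner_axis_axis)
      have pos: "1 + t\<^sup>2 > 0" by (simp add: add_pos_nonneg)
      let ?R = "reflection a ** reflection ?x"
      have "transpose ?R ** ?R = transpose (reflection ?x) ** (transpose (reflection a) ** reflection a) ** reflection ?x"
        by (simp add: matrix_transpose_mul matrix_mul_assoc)
      also have "\<dots> = mat 1" by (simp add: reflection_orthogonal)
      finally have "N \<bullet> ?R \<le> N \<bullet> mat 1" by (rule N)
      moreover have "N \<bullet> ?R = (reflection a ** N) \<bullet> reflection ?x"
        by (metis inner_commute inner_matrix_mult_left transpose_reflection)
      moreover have "\<dots> = (reflection a ** N) \<bullet> mat 1 - 2 * (?x \<bullet> (reflection a *v (N *v ?x)))"
        by (simp add: inner_reflection inner_axis_axis matrix_vector_mul_assoc)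
      moreover have "(reflection a ** N) \<bullet> mat 1 = N \<bullet> reflection a"
        by (simp add: inner_matrix_mult_left transpose_reflection)
      moreover have "\<dots> = N \<bullet> mat 1 - 2 * (a \<bullet> (N *v a) / (1 + t\<^sup>2))"
        by (simp add: inner_reflection aa)
      moreover have "?x \<bullet> (reflection a *v (N *v ?x)) = N $ i $ i - 2 * (a \<bullet> (N *v ?x) / (1 + t\<^sup>2))"
        by (simp add: reflection_vector inner_diff_right aa ax1 ax)
      ultimately have "0 \<le> a \<bullet> (N *v a) / (1 + t\<^sup>2) + N $ i $ i - 2 * (a \<bullet> (N *v ?x) / (1 + t\<^sup>2))"
        by linarith
      also have "\<dots> = (a \<bullet> (N *v a) + (1 + t\<^sup>2) * N $ i $ i - 2 * (a \<bullet> (N *v ?x))) / (1 + t\<^sup>2)"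
        using pos by (simp add: add_divide_distrib diff_divide_distrib)
      finally have "0 \<le> a \<bullet> (N *v a) + (1 + t\<^sup>2) * N $ i $ i - 2 * (a \<bullet> (N *v ?x))"
        using pos unfolding zero_le_divide_iff by argo
      moreover have "a \<bullet> (N *v ?x) = N $ i $ i + t * N $ j $ i"
        by (simp add: a_def inner_add_left ax)
      moreover have "a \<bullet> (N *v a) = N $ i $ i + t * (N $ i $ j + N $ j $ i) + t\<^sup>2 * N $ j $ j"
        by (simp add: a_def inner_add_left matrix_vector_right_distrib inner_add_right ax
            matrix_vector_mult_scaleR power2_eq_square algebra_simps)
      ultimately show ?thesis by (simp add: algebra_simps power2_eq_square)
    qed
    define d where "d = N $ j $ i - N $ i $ j"
    \<comment> \<open>Instead of a limit as \<open>t\<close> tends to 0, one value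
      \<open>t = d / (2 * s)\<close> suffices: a positive \<open>d\<close> would satisfy
      \<open>d \<le> d / 2\<close>. The summand 1 keeps \<open>s\<close> positive.\<close>
    define s where "s = \<bar>N $ i $ i + N $ j $ j\<bar> + 1"
    have s: "s > 0" "N $ i $ i + N $ j $ j \<le> s" by (auto simp: s_def)
    have "d \<le> 0"
    proof (rule ccontr)
      assume "\<not> d \<le> 0"
      then have t: "d / (2 * s) > 0" using s by simp
      with *[of "d / (2 * s)"] have "d \<le> d / (2 * s) * (N $ i $ i + N $ j $ j)"
        unfolding d_def[symmetric] by (simp only: mult_le_cancel_left_pos)
      also have "\<dots> \<le> d / (2 * s) * s" using s t by (intro mult_left_mono) auto
      finally show False using s \<open>\<not> d \<le> 0\<close> by simp
    qed
    then show ?thesis by (simp add: d_def)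
  qed
  have "N $ i $ j = N $ j $ i" for i j
    using comp[of i j] comp[of j i] by (cases "i = j") auto
  then have "transpose N = N"
    by (simp add: vec_eq_iff transpose_def)
  then have "B ** P = N" by (metis N_def transpose_transpose)
  with that P psd \<open>transpose N = N\<close> show thesis by simp
qed

subsection \<open>Spectral truncation\<close>

text \<open>The conditions in \<^const>\<open>hMDS\<close>, for a general matrix \<open>A\<close> in place of \<open>- Y\<close>.\<close>

definition top_eigen ::
    "real^'n^'n \<Rightarrow> real^'r^'n \<Rightarrow> ('n \<Rightarrow> real^'n) \<Rightarrow> ('n \<Rightarrow> real) \<Rightarrow> ('r \<Rightarrow> 'n) \<Rightarrow> bool" where
  "top_eigen A X v l s \<longleftrightarrow>
    (\<forall>a b. v a \<bullet> v b = (if a = b then 1 else 0)) \<and>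
    (\<forall>a. A *v v a = l a *\<^sub>R v a) \<and>
    inj s \<and>
    (\<forall>k. l (s k) \<ge> 0) \<and>
    (\<forall>k. \<forall>a. a \<notin> range s \<longrightarrow> l a \<le> l (s k)) \<and>
    (\<forall>k. column k X = sqrt (l (s k)) *\<^sub>R v (s k))"

lemma hMDS_iff_top_eigen:
  "hMDS H X \<longleftrightarrow> (\<exists>v l s. top_eigen (- (\<chi> i j. cosh (H $ i $ j))) X v l s)"
  by (simp add: hMDS_def top_eigen_def Let_def)

context
  fixes A :: "real^'n^'n" and X :: "real^'r^'n" and v l s
  assumes top: "top_eigen A X v l s"
begin

lemma orthonormal: "v a \<bullet> v b = (if a = b then 1 else 0)"
  and eigen: "A *v v a = l a *\<^sub>R v a"
  and inj_s: "inj s"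
  and selected_nonneg: "0 \<le> l (s k)"
  and selected_top: "a \<notin> range s \<Longrightarrow> l a \<le> l (s k)"
  and column_X: "column k X = sqrt (l (s k)) *\<^sub>R v (s k)"
  using top by (auto simp: top_eigen_def)

lemma transpose_X_vector: "(transpose X *v x) $ k = sqrt (l (s k)) * (v (s k) \<bullet> x)"
proof -
  have "(transpose X *v x) $ k = column k X \<bullet> x"
    by (simp add: inner_vec_def column_def vector_matrix_mult_def mult.commute)
  then show ?thesis by (simp add: column_X)
qed

lemma X_vector: "X *v y = (\<Sum>k\<in>UNIV. (y $ k * sqrt (l (s k))) *\<^sub>R v (s k))"
  by (simp add: matrix_mult_sum column_X scalar_mult_eq_scaleR)

lemma norm_X_vector: "(X *v y) \<bullet> (X *v y) = (\<Sum>k\<in>UNIV. l (s k) * (y $ k)\<^sup>2)"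
proof -
  have "v (s j) \<bullet> v (s k) = (if j = k then 1 else 0)" for j k
    using inj_s by (simp add: orthonormal inj_eq)
  then have "(X *v y) \<bullet> (X *v y) = (\<Sum>k\<in>UNIV. (y $ k * sqrt (l (s k))) * (y $ k * sqrt (l (s k))))"
    by (simp add: X_vector inner_sum_left inner_sum_right if_distrib[of "\<lambda>x. _ * x"] cong: if_cong)
  also have "\<dots> = (\<Sum>k\<in>UNIV. l (s k) * (y $ k)\<^sup>2)"
    by (intro sum.cong refl) (simp add: selected_nonneg power2_eq_square algebra_simps)
  finally show ?thesis .
qed

lemma transpose_X_unselected:
  assumes "a \<notin> range s"
  shows "transpose X *v v a = 0"
proof -
  have "s k \<noteq> a" for k using assms by auto
  then have "(transpose X *v v a) $ k = 0" for k
    unfolding transpose_X_vector by (simp add: orthonormal)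
  then show ?thesis by (simp only: vec_eq_iff zero_index) simp
qed

lemma gram_unselected:
  assumes "a \<notin> range s"
  shows "(X ** transpose X) *v v a = 0"
  using transpose_X_unselected[OF assms] by (simp only: matrix_vector_mul_assoc[symmetric]) simp

lemma gram_selected: "(X ** transpose X) *v v (s k) = l (s k) *\<^sub>R v (s k)"
proof -
  have "transpose X *v v (s k) = sqrt (l (s k)) *\<^sub>R axis k 1"
    unfolding vec_eq_iff transpose_X_vector
    using inj_s by (auto simp: orthonormal inj_eq axis_def)
  then have "(X ** transpose X) *v v (s k) = X *v (sqrt (l (s k)) *\<^sub>R axis k 1)"
    by (simp only: matrix_vector_mul_assoc[symmetric])
  also have "\<dots> = l (s k) *\<^sub>R v (s k)"
    by (simp add: matrix_vector_mult_scaleR matrix_vector_mult_basis column_X selected_nonneg)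
  finally show ?thesis .
qed

text \<open>In the eigenbasis the residual \<open>X ** transpose X - A\<close> vanishes on selected
  vectors. On a dropped one it is multiplication by \<open>- l a\<close>, and there the Gram matrix
  of \<open>X\<close> vanishes, so only the Gram matrix of \<open>Z\<close> contributes.\<close>

lemma inner_gram_residual:
  fixes Z :: "real^'q^'n"
  shows "(X ** transpose X - Z ** transpose Z) \<bullet> (X ** transpose X - A)
    = (\<Sum>a\<in>- range s. l a * ((transpose Z *v v a) \<bullet> (transpose Z *v v a)))"
proof -
  let ?G = "X ** transpose X" and ?B = "Z ** transpose Z"
  have "((?G - ?B) *v v a) \<bullet> ((?G - A) *v v a)
      = (if a \<in> - range s then l a * ((transpose Z *v v a) \<bullet> (transpose Z *v v a)) else 0)" for a
  proof (cases "a \<in> range s")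
    case True
    then show ?thesis
      by (auto simp: matrix_vector_mult_diff_rdistrib gram_selected eigen)
  next
    case False
    have "(?B *v v a) \<bullet> v a = (transpose Z *v v a) \<bullet> (transpose Z *v v a)"
      by (metis dot_lmul_matrix inner_commute matrix_vector_mul_assoc transpose_matrix_vector)
    then show ?thesis
      using False by (simp add: matrix_vector_mult_diff_rdistrib gram_unselected eigen)
  qed
  then show ?thesis
    by (simp add: inner_orthonormal_basis[OF orthonormal] sum.If_cases Compl_eq)
qed

text \<open>Otherwise \<open>A\<close> would exceed \<open>e\<close> on the span of \<open>r + 1\<close> eigenvectors, which meets the
  kernel of \<open>transpose x\<close>.\<close>

lemma unselected_le:
  fixes x :: "real^'r^'n"
  assumes ker: "\<And>y. transpose x *v y = 0 \<Longrightarrow> y \<bullet> (A *v y) \<le> e * (y \<bullet> y)"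
    and a: "a \<notin> range s"
  shows "l a \<le> e"
proof (rule ccontr)
  assume "\<not> l a \<le> e"
  \<comment> \<open>The option type indexes exactly one vector more than \<open>'r\<close>: the
    dropped one at \<open>None\<close>, the selected ones at \<open>Some k\<close>.\<close>
  define w where "w q = (case q of None \<Rightarrow> a | Some k \<Rightarrow> s k)" for q
  have w_inj: "w p = w q \<longleftrightarrow> p = q" for p q
    using a inj_s by (auto simp: w_def inj_eq split: option.splits)
  have l_w: "e < l (w q)" for q
    using \<open>\<not> l a \<le> e\<close> selected_top[OF a] by (auto simp: w_def not_le less_le_trans split: option.splits)
  define W :: "real^('r option)^'n" where "W = (\<chi> i q. v (w q) $ i)"
  have W: "W *v c = (\<Sum>q\<in>UNIV. c $ q *\<^sub>R v (w q))" for c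
    by (simp add: W_def matrix_mult_sum scalar_mult_eq_scaleR column_def)
  \<comment> \<open>This matrix has fewer rows than columns, so some nonzero combination of the
    chosen eigenvectors lies in the kernel of \<open>transpose x\<close>.\<close>
  have "rank (transpose x ** W) < CARD('r option)"
    using rank_bound[of "transpose x ** W"] by simp
  then obtain c where c: "c \<noteq> 0" "(transpose x ** W) *v c = 0"
    using matrix_nonfull_linear_equations_eq[of "transpose x ** W"] by auto
  define y where "y = W *v c"
  have "transpose x *v y = 0"
    using c(2) unfolding y_def by (simp only: matrix_vector_mul_assoc)
  then have le: "y \<bullet> (A *v y) \<le> e * (y \<bullet> y)" by (rule ker)
  have y: "y = (\<Sum>q\<in>UNIV. c $ q *\<^sub>R v (w q))" by (simp add: y_def W)
  have Ay: "A *v y = (\<Sum>q\<in>UNIV. (c $ q * l (w q)) *\<^sub>R v (w q))"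
    unfolding y by (simp add: linear_sum[OF matrix_vector_mul_linear] matrix_vector_mult_scaleR eigen)
  have yy: "y \<bullet> y = (\<Sum>q\<in>UNIV. (c $ q)\<^sup>2)"
    unfolding y by (simp add: inner_sum_left inner_sum_right orthonormal w_inj power2_eq_square
        if_distrib[of "\<lambda>x. _ * x"] cong: if_cong)
  have yAy: "y \<bullet> (A *v y) = (\<Sum>q\<in>UNIV. l (w q) * (c $ q)\<^sup>2)"
    unfolding Ay unfolding y by (simp add: inner_sum_left inner_sum_right orthonormal w_inj power2_eq_square
        if_distrib[of "\<lambda>x. _ * x"] mult_ac cong: if_cong)
  obtain q where q: "c $ q \<noteq> 0" using c(1) by (auto simp: vec_eq_iff)
  have "(\<Sum>q\<in>UNIV. e * (c $ q)\<^sup>2) < (\<Sum>q\<in>UNIV. l (w q) * (c $ q)\<^sup>2)"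
  proof (rule sum_strict_mono_ex1)
    show "\<forall>q\<in>UNIV. e * (c $ q)\<^sup>2 \<le> l (w q) * (c $ q)\<^sup>2"
      using less_imp_le[OF l_w] by (auto intro: mult_right_mono)
    show "\<exists>q\<in>UNIV. e * (c $ q)\<^sup>2 < l (w q) * (c $ q)\<^sup>2"
      using q by (intro bexI[where x = q] mult_strict_right_mono l_w) simp_all
  qed simp
  then show False using le by (simp add: yy yAy sum_distrib_left)
qed

section \<open>Nonzero spectrum of the Gram matrix\<close>

lemma selected_pos:
  assumes "rank X = CARD('r)"
  shows "0 < l (s k)"
proof (rule ccontr)
  assume "\<not> 0 < l (s k)"
  then have "X *v axis k 1 = X *v 0"
    using selected_nonneg[of k] by (simp add: matrix_vector_mult_basis column_X)
  moreover have "inj ((*v) X)" using assms by (simp add: full_rank_injective)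
  ultimately have "axis k 1 = (0 :: real^'r)" by (meson injD)
  then show False by (simp add: axis_eq_0_iff)
qed

text \<open>An eigenvector with nonzero eigenvalue cannot be orthogonal to all selected vectors, and
  pairing it with one of them identifies the eigenvalues. Hence the minimum in
  \<open>lambda_min\<close> runs over a finite nonempty set of positive numbers.\<close>

lemma eigenvalues_gram:
  assumes "rank X = CARD('r)"
  shows "eigenvalues (X ** transpose X) - {0} = range (\<lambda>k. l (s k))"
proof (intro equalityI subsetI)
  fix c assume "c \<in> eigenvalues (X ** transpose X) - {0}"
  then obtain x where x: "x \<noteq> 0" "(X ** transpose X) *v x = c *\<^sub>R x" "c \<noteq> 0"
    by (auto simp: eigenvalues_def)
  have "X *v (transpose X *v x) \<noteq> 0"
    using x by (simp only: matrix_vector_mul_assoc) simp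
  then have "transpose X *v x \<noteq> 0" by (metis matrix_vector_mult_0_right)
  then obtain k where "(transpose X *v x) $ k \<noteq> 0" by (auto simp only: vec_eq_iff zero_index)
  then have k: "v (s k) \<bullet> x \<noteq> 0" unfolding transpose_X_vector by simp
  have "c * (v (s k) \<bullet> x) = v (s k) \<bullet> ((X ** transpose X) *v x)"
    by (simp add: x)
  also have "\<dots> = ((X ** transpose X) *v v (s k)) \<bullet> x"
    by (metis dot_lmul_matrix matrix_transpose_mul transpose_matrix_vector transpose_transpose)
  also have "\<dots> = l (s k) * (v (s k) \<bullet> x)"
    by (simp add: gram_selected)
  finally show "c \<in> range (\<lambda>k. l (s k))" using k by simp
next
  fix c assume "c \<in> range (\<lambda>k. l (s k))"
  then obtain k where k: "c = l (s k)" by auto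
  have "v (s k) \<noteq> 0" using orthonormal[of "s k" "s k"] by auto
  then show "c \<in> eigenvalues (X ** transpose X) - {0}"
    using gram_selected selected_pos[OF assms, of k] by (auto simp: eigenvalues_def k)
qed

lemma lambda_min_pos:
  assumes "rank X = CARD('r)"
  shows "0 < lambda_min X"
  unfolding lambda_min_def eigenvalues_gram[OF assms]
  by (subst Min_gr_iff) (auto intro: selected_pos[OF assms])

lemma lambda_min_bound:
  assumes "rank X = CARD('r)"
  shows "lambda_min X * (y \<bullet> y) \<le> (X *v y) \<bullet> (X *v y)"
proof -
  have "lambda_min X \<le> l (s k)" for k
    unfolding lambda_min_def eigenvalues_gram[OF assms] by (intro Min_le) auto
  then have "(\<Sum>k\<in>UNIV. lambda_min X * (y $ k)\<^sup>2) \<le> (\<Sum>k\<in>UNIV. l (s k) * (y $ k)\<^sup>2)"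
    by (intro sum_mono mult_right_mono) auto
  then show ?thesis
    unfolding norm_X_vector by (simp add: inner_vec_def power2_eq_square sum_distrib_left)
qed

end

text \<open>With \<open>G\<close> and \<open>G'\<close> the two Gram matrices, \<open>G' - G\<close> splits as
  \<open>(A' - A) + (G' - A') - (G - A)\<close>; paired with \<open>G' - G\<close>, the third part contributes
  nothing positive and the second at most \<open>e * (norm (G' - G))\<^sup>2 / \<lambda>\<close>.\<close>

lemma gram_perturbation:
  fixes X X' :: "real^'r^'n"
  assumes top: "top_eigen A X v l s" and top': "top_eigen A' X' v' l' s'"
    and full: "rank X = CARD('r)"
    and unsel: "\<And>a. a \<notin> range s \<Longrightarrow> l a \<le> 0"
    and unsel': "\<And>a. a \<notin> range s' \<Longrightarrow> l' a \<le> e"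
    and e: "norm (A' - A) \<le> e" "e < lambda_min X"
  shows "norm (X' ** transpose X' - X ** transpose X) * (lambda_min X - e) \<le> lambda_min X * e"
proof -
  define G where "G = X ** transpose X"
  define G' where "G' = X' ** transpose X'"
  define g where "g = norm (G' - G)"
  have lam: "0 < lambda_min X" by (rule lambda_min_pos[OF top full])
  have e0: "0 \<le> e" using e(1) norm_ge_zero order_trans by blast
  have gg: "g\<^sup>2 = (G' - G) \<bullet> (G' - G)" by (simp add: g_def power2_norm_eq_inner)
  have "(G - G') \<bullet> (G - A) = (\<Sum>a\<in>- range s. l a * ((transpose X' *v v a) \<bullet> (transpose X' *v v a)))"
    unfolding G_def G'_def by (rule inner_gram_residual[OF top])
  also have "\<dots> \<le> 0"
    using unsel by (intro sum_nonpos) (auto intro: mult_nonpos_nonneg)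
  finally have third: "(G - G') \<bullet> (G - A) \<le> 0" .
  let ?N = "\<lambda>a. (transpose X *v v' a) \<bullet> (transpose X *v v' a)"
  \<comment> \<open>On vectors dropped for \<open>A'\<close> the matrix \<open>G'\<close> vanishes,
    so \<open>G' - G\<close> acts as \<open>- G\<close> and dominates \<open>?N a\<close>. The
    second part is thus controlled by the very difference being estimated.\<close>
  have "lambda_min X * (\<Sum>a\<in>- range s'. ?N a) \<le> (\<Sum>a\<in>- range s'. ((G' - G) *v v' a) \<bullet> ((G' - G) *v v' a))"
    unfolding sum_distrib_left
  proof (rule sum_mono)
    fix a assume "a \<in> - range s'"
    then have "(G' - G) *v v' a = - (X *v (transpose X *v v' a))"
      using gram_unselected[OF top', of a]
      by (simp only: G_def G'_def matrix_vector_mult_diff_rdistrib matrix_vector_mul_assoc) simp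
    then show "lambda_min X * ?N a \<le> ((G' - G) *v v' a) \<bullet> ((G' - G) *v v' a)"
      using lambda_min_bound[OF top full, of "transpose X *v v' a"] by simp
  qed
  also have "\<dots> \<le> (\<Sum>a\<in>UNIV. ((G' - G) *v v' a) \<bullet> ((G' - G) *v v' a))"
    by (rule sum_mono2) auto
  also have "\<dots> = g\<^sup>2"
    unfolding gg by (rule inner_orthonormal_basis[OF orthonormal[OF top'], symmetric])
  finally have N: "lambda_min X * (\<Sum>a\<in>- range s'. ?N a) \<le> g\<^sup>2" .
  have "(G' - G) \<bullet> (G' - A') = (\<Sum>a\<in>- range s'. l' a * ?N a)"
    unfolding G_def G'_def by (rule inner_gram_residual[OF top'])
  also have "\<dots> \<le> (\<Sum>a\<in>- range s'. e * ?N a)"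
    using unsel' by (intro sum_mono mult_right_mono) auto
  finally have "(G' - G) \<bullet> (G' - A') \<le> e * (\<Sum>a\<in>- range s'. ?N a)"
    by (simp only: sum_distrib_left)
  then have "lambda_min X * ((G' - G) \<bullet> (G' - A')) \<le> e * (lambda_min X * (\<Sum>a\<in>- range s'. ?N a))"
    using lam by (simp add: mult.left_commute)
  also have "\<dots> \<le> e * g\<^sup>2" by (rule mult_left_mono[OF N e0])
  finally have second: "lambda_min X * ((G' - G) \<bullet> (G' - A')) \<le> e * g\<^sup>2" .
  have "(G' - G) \<bullet> (A' - A) \<le> g * norm (A' - A)"
    unfolding g_def by (rule norm_cauchy_schwarz)
  also have "\<dots> \<le> g * e" using e(1) by (simp add: g_def mult_left_mono)
  finally have first: "(G' - G) \<bullet> (A' - A) \<le> g * e" .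
  have "g\<^sup>2 = (G' - G) \<bullet> (A' - A) + (G' - G) \<bullet> (G' - A') + (G - G') \<bullet> (G - A)"
    unfolding gg by (simp add: inner_diff_left inner_diff_right inner_commute)
  also have "\<dots> \<le> g * e + (G' - G) \<bullet> (G' - A')"
    using first third by simp
  finally have "lambda_min X * g\<^sup>2 \<le> lambda_min X * (g * e + (G' - G) \<bullet> (G' - A'))"
    using lam by simp
  also have "\<dots> \<le> lambda_min X * (g * e) + e * g\<^sup>2"
    using second by (simp add: distrib_left)
  finally have *: "g * (g * (lambda_min X - e)) \<le> g * (lambda_min X * e)"
    by (simp add: power2_eq_square algebra_simps)
  show ?thesis
  proof (cases "g = 0")
    case True
    then show ?thesis using lam e0 by (simp add: g_def G_def G'_def)
  next
    case False
    then have "g > 0" by (simp add: g_def)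
    with * show ?thesis by (simp add: g_def G_def G'_def)
  qed
qed

lemma config_gap_E_le:
  fixes X X' :: "real^'r^'n"
  assumes lam: "0 < c" "\<And>y. c * (y \<bullet> y) \<le> (X *v y) \<bullet> (X *v y)"
  shows "config_gap_E X X' \<le> 5 / (4 * c) * (norm (X' ** transpose X' - X ** transpose X))\<^sup>2"
proof -
  obtain P :: "real^'r^'r" where P: "transpose P ** P = mat 1"
      and sym: "transpose ((transpose X ** X') ** P) = (transpose X ** X') ** P"
      and psd: "\<And>y. 0 \<le> y \<bullet> (((transpose X ** X') ** P) *v y)"
    using polar_factor[of "transpose X ** X'"] by blast
  have gap: "config_gap Y Z = (Y - Z) \<bullet> (Y - Z)" for Y Z :: "real^'r^'n"
    by (simp add: config_gap_def trace_eq_inner)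
  \<comment> \<open>The infimum is bounded by its value at the aligning \<open>P\<close>; turning
    \<open>X'\<close> by \<open>P\<close> leaves its Gram matrix unchanged.\<close>
  have "P ** transpose P = mat 1"
    using P by (simp add: matrix_left_right_inverse)
  then have ZZ: "(X' ** P) ** transpose (X' ** P) = X' ** transpose X'"
    by (metis matrix_mul_assoc matrix_mul_rid matrix_transpose_mul)
  have "config_gap_E X X' \<le> config_gap X (X' ** P)"
    unfolding config_gap_E_def
    using P by (intro cINF_lower bdd_belowI2[of _ 0]) (auto simp: gap)
  also have "\<dots> \<le> 5 / (4 * c) * (norm (X' ** transpose X' - X ** transpose X))\<^sup>2"
    using procrustes_bound[of X "X' ** P" c] sym psd lam
    by (simp add: gap ZZ matrix_mul_assoc field_simps)
  finally show ?thesis .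
qed

lemma config_gap_E_top_eigen:
  fixes X X' :: "real^'r^'n"
  assumes top: "top_eigen A X v l s" and top': "top_eigen A' X' v' l' s'"
    and full: "rank X = CARD('r)"
    and unsel: "\<And>a. a \<notin> range s \<Longrightarrow> l a \<le> 0"
    and unsel': "\<And>a. a \<notin> range s' \<Longrightarrow> l' a \<le> e"
    and e: "norm (A' - A) \<le> e" "e \<le> lambda_min X / 5"
  shows "config_gap_E X X' \<le> 2 / lambda_min X * e\<^sup>2"
proof -
  define c where "c = lambda_min X"
  define g where "g = norm (X' ** transpose X' - X ** transpose X)"
  have c: "0 < c" unfolding c_def by (rule lambda_min_pos[OF top full])
  have "g * (c - e) \<le> c * e"
    unfolding c_def g_def
    using e c by (intro gram_perturbation[OF top top' full unsel unsel']) (auto simp: c_def)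
  moreover have "g * (c * (4 / 5)) \<le> g * (c - e)"
    using e by (intro mult_left_mono) (auto simp: c_def g_def)
  ultimately have "c * (g * (4 / 5)) \<le> c * e" by (simp only: mult.left_commute)
  then have "g \<le> 5 / 4 * e" using c by simp
  then have "g\<^sup>2 \<le> (5 / 4 * e)\<^sup>2" by (rule power_mono) (simp add: g_def)
  then have "g\<^sup>2 \<le> 25 / 16 * e\<^sup>2"
    unfolding power_mult_distrib by (simp add: power2_eq_square[of "5 / 4"])
  \<comment> \<open>The value 8/5 is chosen because 5/4 times 8/5 is exactly the constant 2 of the
    claim.\<close>
  also have "\<dots> \<le> 8 / 5 * e\<^sup>2"
    by (rule mult_right_mono) auto
  finally have "5 / (4 * c) * g\<^sup>2 \<le> 5 / (4 * c) * (8 / 5 * e\<^sup>2)"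
    using c by (intro mult_left_mono) auto
  moreover have "config_gap_E X X' \<le> 5 / (4 * c) * g\<^sup>2"
    unfolding g_def c_def
    using lambda_min_bound[OF top full] c by (intro config_gap_E_le) (auto simp: c_def)
  ultimately show ?thesis by (simp add: c_def)
qed

subsection \<open>The matrix of hyperbolic cosines\<close>

lemma mink_inner:
  "x \<bullet> (mink_Q *v y) = x $ None * y $ None - (\<Sum>k\<in>UNIV. x $ Some k * y $ Some k)"
proof -
  have "(mink_Q *v y) $ a = (if a = None then y $ a else - y $ a)" for a
    by (simp add: mink_Q_def matrix_vector_mult_def if_distrib[of "\<lambda>x. x * _"] cong: if_cong)
  then show ?thesis
    by (simp add: inner_vec_def UNIV_option_conv sum.reindex sum_negf)
qed

text \<open>Reverse Cauchy-Schwarz inequality, from (1 + s^2)(1 + t^2) = (1 + s t)^2 + (s - t)^2 for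
  the norms s, t of the space-like parts. It places the argument of \<open>arcosh\<close> in its
  domain.\<close>

lemma mink_inner_ge_1:
  assumes "x \<in> hyperboloid" "y \<in> hyperboloid"
  shows "1 \<le> x \<bullet> (mink_Q *v y)"
proof -
  define a b :: "real^'a" where "a = (\<chi> k. x $ Some k)" and "b = (\<chi> k. y $ Some k)"
  have x: "(x $ None)\<^sup>2 = 1 + (norm a)\<^sup>2" "0 < x $ None"
    using assms(1) unfolding hyperboloid_def mem_Collect_eq mink_inner power2_norm_eq_inner
    by (auto simp: a_def inner_vec_def power2_eq_square)
  have y: "(y $ None)\<^sup>2 = 1 + (norm b)\<^sup>2" "0 < y $ None"
    using assms(2) unfolding hyperboloid_def mem_Collect_eq mink_inner power2_norm_eq_inner
    by (auto simp: b_def inner_vec_def power2_eq_square)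
  have "1 + norm a * norm b \<le> x $ None * y $ None"
  proof (rule power2_le_imp_le)
    have "(x $ None * y $ None)\<^sup>2 = (1 + norm a * norm b)\<^sup>2 + (norm a - norm b)\<^sup>2"
      unfolding power_mult_distrib x y by (simp add: power2_eq_square algebra_simps)
    then show "(1 + norm a * norm b)\<^sup>2 \<le> (x $ None * y $ None)\<^sup>2" by simp
  qed (use x y in simp)
  moreover have "a \<bullet> b \<le> norm a * norm b" by (rule norm_cauchy_schwarz)
  moreover have "x \<bullet> (mink_Q *v y) = x $ None * y $ None - a \<bullet> b"
    unfolding mink_inner by (simp add: a_def b_def inner_vec_def)
  ultimately show ?thesis by linarith
qed

lemma cosh_hyp_dist:
  assumes "x \<in> hyperboloid" "y \<in> hyperboloid"
  shows "cosh (hyp_dist x y) = x \<bullet> (mink_Q *v y)"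
  using mink_inner_ge_1[OF assms] by (simp add: hyp_dist_def)

lemma hyp_dist_nonneg:
  assumes "x \<in> hyperboloid" "y \<in> hyperboloid"
  shows "0 \<le> hyp_dist x y"
  using mink_inner_ge_1[OF assms] by (simp add: hyp_dist_def)

text \<open>The cosine matrix is a rank-one square of the time-like coordinates minus the Gram
  matrix of the space-like ones. The latter vanishes on the kernel, leaving the square of a linear
  form.\<close>

lemma cosh_matrix_nonneg_on_kernel:
  fixes p :: "'n::finite \<Rightarrow> real^('r::finite option)"
  assumes "\<And>i. p i \<in> hyperboloid"
    and ker: "transpose (\<chi> i k. p i $ Some k :: real^'r^'n) *v y = 0"
  shows "0 \<le> y \<bullet> ((\<chi> i j. cosh (hyp_dist (p i) (p j))) *v y)"
proof -
  let ?x = "\<chi> i k. p i $ Some k :: real^'r^'n"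
  have "(\<chi> i j. cosh (hyp_dist (p i) (p j))) *v y
      = (\<Sum>j\<in>UNIV. p j $ None * y $ j) *\<^sub>R (\<chi> i. p i $ None) - ?x *v (transpose ?x *v y)"
  proof -
    have "(\<Sum>j\<in>UNIV. (\<Sum>k\<in>UNIV. p i $ Some k * p j $ Some k) * y $ j)
        = (\<Sum>k\<in>UNIV. p i $ Some k * (\<Sum>j\<in>UNIV. p j $ Some k * y $ j))" for i
      unfolding sum_distrib_left sum_distrib_right by (subst sum.swap) (simp add: mult_ac)
    moreover have "(\<chi> i j. cosh (hyp_dist (p i) (p j)))
        = (\<chi> i j. p i $ None * p j $ None - (\<Sum>k\<in>UNIV. p i $ Some k * p j $ Some k))"
      by (simp add: cosh_hyp_dist assms(1) mink_inner)
    ultimately show ?thesis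
      by (simp add: vec_eq_iff matrix_vector_mult_def vector_matrix_mult_def transpose_def
          left_diff_distrib right_diff_distrib sum_subtractf sum_distrib_left sum_distrib_right mult_ac)
  qed
  then have "y \<bullet> ((\<chi> i j. cosh (hyp_dist (p i) (p j))) *v y)
      = (\<Sum>j\<in>UNIV. p j $ None * y $ j) * (\<Sum>j\<in>UNIV. p j $ None * y $ j)"
    unfolding ker by (simp add: inner_vec_def sum_distrib_left mult_ac)
  then show ?thesis by simp
qed

section \<open>Taylor estimate for the cosine matrix\<close>

lemma cosh_perturbation:
  fixes a t h :: real
  assumes "0 \<le> a" "a \<le> h" "\<bar>t\<bar> \<le> 1"
  shows "\<bar>cosh (a + t) - cosh a\<bar> \<le> sinh h * \<bar>t\<bar> + cosh (h + 1) * t\<^sup>2"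
proof -
  define diff where "diff m x = (if even m then cosh (a + x) else sinh (a + x))" for m :: nat and x :: real
  have "\<forall>m x. DERIV (diff m) x :> diff (Suc m) x"
    unfolding diff_def by (auto intro!: derivative_eq_intros)
  from Maclaurin_all_le[OF refl this, of t 2]
  obtain \<xi> where \<xi>: "\<bar>\<xi>\<bar> \<le> \<bar>t\<bar>" "cosh (a + t) = cosh a + sinh a * t + cosh (a + \<xi>) / 2 * t\<^sup>2"
    by (auto simp: diff_def numeral_2_eq_2)
  have "cosh (a + \<xi>) = cosh \<bar>a + \<xi>\<bar>" by simp
  \<comment> \<open>The intermediate point is within 1 of \<open>a\<close>, which makes the
    remainder constant independent of \<open>t\<close>.\<close>
  also have "\<dots> \<le> cosh (h + 1)"
    using assms \<xi>(1) by (subst cosh_real_nonneg_le_iff) auto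
  finally have "cosh (a + \<xi>) / 2 \<le> cosh (h + 1)"
    using cosh_real_pos[of "a + \<xi>"] by linarith
  then have "cosh (a + \<xi>) / 2 * t\<^sup>2 \<le> cosh (h + 1) * t\<^sup>2" by (rule mult_right_mono) simp
  moreover have "0 \<le> cosh (a + \<xi>) / 2 * t\<^sup>2" by simp
  moreover have "\<bar>sinh a * t\<bar> \<le> sinh h * \<bar>t\<bar>"
    using assms by (simp add: abs_mult mult_right_mono)
  ultimately show ?thesis using \<xi>(2) by linarith
qed

lemma max_norm_ge: "\<bar>A $ i $ j\<bar> \<le> max_norm A"
  unfolding max_norm_def by (rule Max_ge) (auto intro: rev_image_eqI[of "(i, j)"])

lemma max_norm_nonneg: "0 \<le> max_norm A"
  using max_norm_ge[of A undefined undefined] by linarith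

lemma cosh_matrix_perturbation:
  fixes H \<Delta> :: "real^'n^'n"
  assumes "\<And>i j. 0 \<le> H $ i $ j" "max_norm \<Delta> \<le> 1"
  shows "norm (- (\<chi> i j. cosh ((H + \<Delta>) $ i $ j)) - - (\<chi> i j. cosh (H $ i $ j)))
    \<le> real CARD('n) * (sinh (max_norm H) * max_norm \<Delta> + cosh (max_norm H + 1) * (max_norm \<Delta>)\<^sup>2)"
proof (rule norm_matrix_le_entries)
  fix i j
  have "H $ i $ j \<le> max_norm H" using max_norm_ge[of H i j] by linarith
  then have "\<bar>cosh (H $ i $ j + \<Delta> $ i $ j) - cosh (H $ i $ j)\<bar>
      \<le> sinh (max_norm H) * \<bar>\<Delta> $ i $ j\<bar> + cosh (max_norm H + 1) * (\<Delta> $ i $ j)\<^sup>2"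
    using max_norm_ge[of \<Delta> i j] assms by (intro cosh_perturbation) auto
  also have "\<dots> \<le> sinh (max_norm H) * max_norm \<Delta> + cosh (max_norm H + 1) * (max_norm \<Delta>)\<^sup>2"
  proof (intro add_mono mult_left_mono)
    show "(\<Delta> $ i $ j)\<^sup>2 \<le> (max_norm \<Delta>)\<^sup>2"
      using power_mono[OF max_norm_ge[of \<Delta> i j], of 2] by simp
  qed (auto simp: max_norm_ge max_norm_nonneg)
  finally show "\<bar>(- (\<chi> i j. cosh ((H + \<Delta>) $ i $ j)) - - (\<chi> i j. cosh (H $ i $ j))) $ i $ j\<bar>
      \<le> sinh (max_norm H) * max_norm \<Delta> + cosh (max_norm H + 1) * (max_norm \<Delta>)\<^sup>2"
    by (simp add: abs_minus_commute)
qed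

text \<open>Neglecting higher orders is made precise by a cubic remainder whose constant and radius
  are fixed before the perturbation and its output are chosen.\<close>

theorem lemmaF1:
  fixes p :: "'n::finite \<Rightarrow> real ^ ('r::finite option)"
    and H :: "real ^ 'n ^ 'n"
    and X :: "real ^ 'r ^ 'n"
  assumes points: "\<And>i. p i \<in> hyperboloid"
    and dist_matrix: "H = (\<chi> i j. hyp_dist (p i) (p j))"
    and recovered: "hMDS H X"
    and full_rank: "rank X = CARD('r)"
  shows "\<exists>C>0. \<exists>\<delta>>0. \<forall>(\<Delta> :: real ^ 'n ^ 'n) (X' :: real ^ 'r ^ 'n).
           transpose \<Delta> = \<Delta> \<and> (\<forall>i. \<Delta> $ i $ i = 0) \<and> max_norm \<Delta> \<le> \<delta> \<and> hMDS (H + \<Delta>) X' \<longrightarrow>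
           config_gap_E X X' \<le>
             2 * (real CARD('n))\<^sup>2 / lambda_min X * (sinh (max_norm H))\<^sup>2 * (max_norm \<Delta>)\<^sup>2
             + C * max_norm \<Delta> ^ 3"
proof -
  define A where "A = - (\<chi> i j. cosh (H $ i $ j))"
  define x :: "real^'r^'n" where "x = (\<chi> i k. p i $ Some k)"
  define n where "n = real CARD('n)"
  define \<sigma> where "\<sigma> = sinh (max_norm H)"
  define c where "c = cosh (max_norm H + 1)"
  define lam where "lam = lambda_min X"
  \<comment> \<open>The bound 1 serves the Taylor estimate; the other bound forces
    \<open>e \<le> lam / 5\<close> below.\<close>
  define \<delta> where "\<delta> = min 1 (lam / (5 * n * (\<sigma> + c)))"
  \<comment> \<open>Collects the cubic and quartic terms of \<open>e\<^sup>2\<close>, the quartic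
    one being at most cubic since \<open>m \<le> 1\<close>.\<close>
  define C where "C = 2 * n\<^sup>2 / lam * (2 * \<sigma> * c + c\<^sup>2)"
  obtain v l s where top: "top_eigen A X v l s"
    using recovered unfolding hMDS_iff_top_eigen A_def by blast
  have pos: "0 < lam" "0 < n" "0 \<le> \<sigma>" "0 < c"
    using lambda_min_pos[OF top full_rank] by (auto simp: lam_def n_def \<sigma>_def c_def max_norm_nonneg)
  have H_nonneg: "0 \<le> H $ i $ j" for i j
    by (simp add: dist_matrix hyp_dist_nonneg points)
  have ker: "y \<bullet> (A *v y) \<le> 0" if "transpose x *v y = 0" for y
  proof -
    have "A *v y = - ((\<chi> i j. cosh (hyp_dist (p i) (p j))) *v y)"
      by (simp add: A_def dist_matrix vec_eq_iff matrix_vector_mult_def sum_negf)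
    then show ?thesis
      using cosh_matrix_nonneg_on_kernel[of p y] points that unfolding x_def by simp
  qed
  have "config_gap_E X X' \<le> 2 * n\<^sup>2 / lam * \<sigma>\<^sup>2 * (max_norm \<Delta>)\<^sup>2 + C * max_norm \<Delta> ^ 3"
    if small: "max_norm \<Delta> \<le> \<delta>" and rec: "hMDS (H + \<Delta>) X'" for \<Delta> and X' :: "real^'r^'n"
  proof -
    define A' where "A' = - (\<chi> i j. cosh ((H + \<Delta>) $ i $ j))"
    define m where "m = max_norm \<Delta>"
    define e where "e = n * (\<sigma> * m + c * m\<^sup>2)"
    have m: "0 \<le> m" "m \<le> 1" "m \<le> lam / (5 * n * (\<sigma> + c))"
      using small max_norm_nonneg[of \<Delta>] by (auto simp: m_def \<delta>_def)
    obtain v' l' s' where top': "top_eigen A' X' v' l' s'"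
      using rec unfolding hMDS_iff_top_eigen A'_def by blast
    have E: "norm (A' - A) \<le> e"
      using cosh_matrix_perturbation[of H \<Delta>] H_nonneg m
      unfolding A_def A'_def e_def n_def \<sigma>_def c_def m_def by simp
    have "c * m\<^sup>2 \<le> c * m"
      using m pos by (simp add: power2_eq_square mult_left_le)
    then have "e \<le> n * ((\<sigma> + c) * m)"
      unfolding e_def using pos by (intro mult_left_mono) (auto simp: algebra_simps)
    also have "\<dots> \<le> n * ((\<sigma> + c) * (lam / (5 * n * (\<sigma> + c))))"
      using m pos by (intro mult_left_mono) auto
    also have "\<dots> = lam / 5"
      using pos add_nonneg_pos[OF pos(3,4)] by simp
    finally have e: "e \<le> lambda_min X / 5" by (simp add: lam_def)
    have "l a \<le> 0" if "a \<notin> range s" for a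
      using ker that by (intro unselected_le[OF top, of x]) auto
    \<comment> \<open>The kernel of \<open>transpose x\<close> for the unperturbed points serves
      \<open>A'\<close> too: there the quadratic form of \<open>A\<close> is at most 0 and
      \<open>A' - A\<close> adds at most \<open>e * (y \<bullet> y)\<close>.\<close>
    moreover have "l' a \<le> e" if "a \<notin> range s'" for a
    proof (rule unselected_le[OF top' _ that])
      fix y assume "transpose x *v y = 0"
      then have "y \<bullet> (A *v y) \<le> 0" by (rule ker)
      moreover have "y \<bullet> ((A' - A) *v y) \<le> norm y * norm ((A' - A) *v y)"
        by (rule norm_cauchy_schwarz)
      moreover have "\<dots> \<le> norm y * (e * norm y)"
        by (intro mult_left_mono order_trans[OF norm_matrix_vector_le] mult_right_mono E) auto
      moreover have "\<dots> = e * (y \<bullet> y)"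
        unfolding power2_norm_eq_inner[symmetric] by (simp add: power2_eq_square)
      moreover have "y \<bullet> (A' *v y) = y \<bullet> (A *v y) + y \<bullet> ((A' - A) *v y)"
        by (simp add: matrix_vector_mult_diff_rdistrib inner_diff_right)
      ultimately show "y \<bullet> (A' *v y) \<le> e * (y \<bullet> y)" by linarith
    qed
    ultimately have "config_gap_E X X' \<le> 2 / lam * e\<^sup>2"
      unfolding lam_def using config_gap_E_top_eigen[OF top top' full_rank _ _ E e] by blast
    also have "e\<^sup>2 = n\<^sup>2 * (\<sigma>\<^sup>2 * m\<^sup>2 + (2 * \<sigma> * c) * m ^ 3 + c\<^sup>2 * m ^ 4)"
      by (simp add: e_def power2_eq_square power3_eq_cube power4_eq_xxxx algebra_simps)
    also have "2 / lam * \<dots> \<le> 2 / lam * (n\<^sup>2 * (\<sigma>\<^sup>2 * m\<^sup>2 + (2 * \<sigma> * c) * m ^ 3 + c\<^sup>2 * m ^ 3))"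
      using m pos by (intro mult_left_mono add_left_mono power_decreasing) auto
    also have "\<dots> = 2 * n\<^sup>2 / lam * \<sigma>\<^sup>2 * m\<^sup>2 + C * m ^ 3"
      by (simp add: C_def algebra_simps)
    finally show ?thesis unfolding m_def .
  qed
  moreover have "0 < 2 * \<sigma> * c + c\<^sup>2" using pos by (intro add_nonneg_pos) auto
  then have "0 < C" unfolding C_def using pos by simp
  moreover have "0 < \<delta>" unfolding \<delta>_def using pos by (auto intro!: divide_pos_pos mult_pos_pos add_nonneg_pos)
  ultimately show ?thesis
    unfolding n_def lam_def \<sigma>_def by blast
qed

end
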